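(* Let $G$ be a connected graph with no isolated vertices, with vertex set $V(G)$ and $|V(G)|=n$. For every $A\in\mathcal{S}(G)$, the support of any nonzero null vector of $A$ is a fort of $G$. Conversely, for any fort $F$ of $G$ and any vector $x\in\mathbb{R}^n$ whose support is $F$, there is a matrix $A\in\mathcal{S}(G)$ that has $x$ as a null vector (i.e. $Ax=0$). That is, $\operatorname{spark}(G)$ is the cardinality of a minimum fort of $G$ (a fort of $G$ of smallest size).
   Context: Graphs are finite, simple and undirected. For a graph $G$ with vertices $v_1,\dots,v_n$, $\mathcal{S}(G)$ is the set of real symmetric $n\times n$ matrices $A=[a_{ij}]$ such that for $i\neq j$, $a_{ij}\neq 0$ if and only if $v_iv_j$ is an edge of $G$ (diagonal entries are unrestricted). Column indices of $A$ and vertices of $G$ are identified. The support of a vector $x$ is $\{i : x_i\neq 0\}$. A fort of $G$ is a nonempty subset $F\subseteq V(G)$ such that no vertex outside $F$ is adjacent to exactly one vertex of $F$. The spark of a real symmetric $n\times n$ matrix $A$, $\operatorname{spark}(A)$, is the smallest integer $s$ such that some $s$ columns of $A$ are linearly dependent (equivalently the minimum size of the support of a nonzero null vector of $A$); if $A$ is nonsingular, $\operatorname{spark}(A)=n+1$. The spark of a graph is $\operatorname{spark}(G)=\min_{A\in\mathcal{S}(G)}\operatorname{spark}(A)$. *)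

theory Defs
  imports
    "HOL-Analysis.Analysis"
    "Graph_Theory.Pair_Digraph"
    "Graph_Theory.Digraph_Component"
begin

text \<open>
  A simple undirected graph is a \<open>pair_graph\<close>: a finite loopless digraph whose arc relation
  \<open>parcs G\<close> is symmetric, an edge \<open>{u, v}\<close> being the two arcs \<open>(u, v)\<close> and \<open>(v, u)\<close>.
  Vertices and matrix indices are identified by taking the vertex set to be all of a finite
  type \<open>'n\<close>, so that \<open>n = CARD('n)\<close>.
\<close>

definition no_isolated_vertices :: "'v pair_pre_digraph \<Rightarrow> bool" where
  "no_isolated_vertices G \<longleftrightarrow> (\<forall>v\<in>pverts G. \<exists>w\<in>pverts G. (v, w) \<in> parcs G)"

definition fort :: "'v pair_pre_digraph \<Rightarrow> 'v set \<Rightarrow> bool" where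
  "fort G F \<longleftrightarrow> F \<noteq> {} \<and> F \<subseteq> pverts G \<and>
     (\<forall>v\<in>pverts G - F. card {w \<in> F. (v, w) \<in> parcs G} \<noteq> 1)"

definition graph_matrices :: "'n pair_pre_digraph \<Rightarrow> (real^'n^'n) set" where
  "graph_matrices G = {A. transpose A = A \<and>
     (\<forall>i j. i \<noteq> j \<longrightarrow> (A $ i $ j \<noteq> 0 \<longleftrightarrow> (i, j) \<in> parcs G))}"

definition support :: "real^'n \<Rightarrow> 'n set" where
  "support x = {i. x $ i \<noteq> 0}"

text \<open>
  Linear dependence of the columns with index in \<open>J\<close> is dependence of an indexed family
  (two equal columns are dependent), which \<open>dependent\<close> applied to the set of columns would miss.
\<close>

definition dependent_columns :: "real^'n^'n \<Rightarrow> 'n set \<Rightarrow> bool" where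
  "dependent_columns A J \<longleftrightarrow>
     (\<exists>c. (\<exists>j\<in>J. c j \<noteq> 0) \<and> (\<Sum>j\<in>J. c j *\<^sub>R column j A) = 0)"

definition spark :: "real^'n^'n \<Rightarrow> nat" where
  "spark A = (if invertible A then CARD('n) + 1
     else (LEAST s. \<exists>J. card J = s \<and> dependent_columns A J))"

text \<open>
  The infimum below is a minimum: it is over a nonempty set of natural numbers, as
  \<open>graph_matrices G\<close> contains the adjacency matrix of \<open>G\<close>.
\<close>

definition graph_spark :: "'n::finite pair_pre_digraph \<Rightarrow> nat" where
  "graph_spark G = (INF A\<in>graph_matrices G. spark A)"

end

theory Submission
  imports Defs
begin

text \<open>
  Row \<open>v\<close> of the equation \<open>A x = 0\<close> behaves in two ways. If \<open>x\<^sub>v \<noteq> 0\<close>, the free diagonal entry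
  \<open>a\<^sub>v\<^sub>v\<close> can absorb whatever the rest of the row contributes, so the row imposes nothing on the
  support. If \<open>x\<^sub>v = 0\<close>, the row says that \<open>\<Sum> a\<^sub>v\<^sub>w x\<^sub>w = 0\<close>, where \<open>w\<close> ranges over the
  neighbours of \<open>v\<close> in the support and every term is nonzero. Nonzero reals with sum zero, indexed
  by a given finite set, exist exactly when the set is not a singleton. This is the fort
  condition at \<open>v\<close>, so supports of null vectors are forts (\<open>fort_support_null_vector\<close>).

  For the converse (\<open>fort_realizable\<close>), the rows can be treated independently despite the symmetry
  of \<open>A\<close>: an entry \<open>a\<^sub>v\<^sub>w\<close> matters to the row of a vertex \<open>v\<close> outside \<open>F\<close> only if \<open>w\<close> lies in \<open>F\<close>,
  so no two rows outside \<open>F\<close> compete for an entry, and rows inside \<open>F\<close> are repaired on the diagonal.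

  Finally, a dependence among columns is a nonzero null vector whose support lies in the index
  set; hence the index set has at least as many elements as a minimum fort. A matrix with the
  indicator vector of a minimum fort as a null vector attains this bound.
\<close>

section \<open>Supports of null vectors are forts\<close>

lemma graph_matrices_nonzero_iff:
  assumes "A \<in> graph_matrices G" and "i \<noteq> j"
  shows "A $ i $ j \<noteq> 0 \<longleftrightarrow> (i, j) \<in> parcs G"
  using assms unfolding graph_matrices_def by blast

lemma matrix_vector_row_support:
  fixes A :: "real^'n^'n"
  assumes "A \<in> graph_matrices G" and "x $ v = 0"
  shows "(A *v x) $ v = (\<Sum>w\<in>{w \<in> support x. (v, w) \<in> parcs G}. A $ v $ w * x $ w)"
  unfolding matrix_vector_mult_def vec_lambda_beta
proof (rule sum.mono_neutral_right)
  show "\<forall>w\<in>UNIV - {w \<in> support x. (v, w) \<in> parcs G}. A $ v $ w * x $ w = 0"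
    using assms(2) graph_matrices_nonzero_iff[OF assms(1), of v] by (fastforce simp: support_def)
qed auto

lemma fort_support_null_vector:
  fixes A :: "real^'n^'n"
  assumes A: "A \<in> graph_matrices G" and V: "pverts G = UNIV"
    and x: "x \<noteq> 0" "A *v x = 0"
  shows "fort G (support x)"
  unfolding fort_def
proof (intro conjI ballI notI)
  show False if "support x = {}"
    using that x(1) by (auto simp: support_def vec_eq_iff)
  show "support x \<subseteq> pverts G" by (simp add: V)
next
  fix v assume v: "v \<in> pverts G - support x"
    and "card {w \<in> support x. (v, w) \<in> parcs G} = 1"
  then obtain w where w: "{w \<in> support x. (v, w) \<in> parcs G} = {w}"
    using card_1_singletonE by blast
  then have "w \<in> support x" "(v, w) \<in> parcs G" by auto
  moreover from v have "x $ v = 0" by (simp add: support_def)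
  moreover from this have "A $ v $ w * x $ w = 0"
    using matrix_vector_row_support[OF A, of x v] x(2) w by simp
  ultimately show False
    using graph_matrices_nonzero_iff[OF A, of v w] by (auto simp: support_def)
qed

section \<open>Every fort is realized by every vector it supports\<close>

lemma nonzero_sum_zero_exists:
  assumes "finite S" and "card S \<noteq> 1"
  shows "\<exists>b :: 'a \<Rightarrow> real. (\<forall>s\<in>S. b s \<noteq> 0) \<and> sum b S = 0"
proof (cases "S = {}")
  case False
  then obtain t where t: "t \<in> S" by auto
  \<comment> \<open>All values are 1 except one, which balances the others and is nonzero as \<open>S\<close> is no singleton.\<close>
  let ?b = "\<lambda>s. if s = t then 1 - real (card S) else 1"
  have "sum ?b (S - {t}) = (\<Sum>s\<in>S - {t}. 1)"
    by (rule sum.cong) auto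
  also have "\<dots> = real (card S) - 1"
    using assms(1) t card_gt_0_iff[of S] by (auto simp: of_nat_diff)
  finally have "sum ?b S = 0"
    using sum.remove[OF assms(1) t, of ?b] by simp
  moreover have "\<forall>s\<in>S. ?b s \<noteq> 0" using assms(2) by auto
  ultimately show ?thesis by (intro exI[of _ ?b] conjI)
qed simp

lemma fort_realizable:
  fixes x :: "real^'n"
  assumes sym: "sym (parcs G)" and V: "pverts G = UNIV" and F: "fort G (support x)"
  shows "\<exists>A\<in>graph_matrices G. A *v x = 0"
proof -
  let ?F = "support x" and ?N = "\<lambda>v. {w \<in> support x. (v, w) \<in> parcs G}"
  have arc_sym: "(i, j) \<in> parcs G \<longleftrightarrow> (j, i) \<in> parcs G" for i j
    using sym by (meson symD)
  have "\<forall>v. \<exists>b :: 'n \<Rightarrow> real. v \<notin> ?F \<longrightarrow> (\<forall>w\<in>?N v. b w \<noteq> 0) \<and> sum b (?N v) = 0"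
  proof
    fix v
    show "\<exists>b :: 'n \<Rightarrow> real. v \<notin> ?F \<longrightarrow> (\<forall>w\<in>?N v. b w \<noteq> 0) \<and> sum b (?N v) = 0"
    proof (cases "v \<in> ?F")
      case False
      then have "card (?N v) \<noteq> 1" using F V unfolding fort_def by blast
      from nonzero_sum_zero_exists[OF _ this] show ?thesis by auto
    qed simp
  qed
  from choice[OF this] obtain b :: "'n \<Rightarrow> 'n \<Rightarrow> real"
    where b0: "\<And>v w. v \<notin> ?F \<Longrightarrow> w \<in> ?N v \<Longrightarrow> b v w \<noteq> 0"
      and b_sum: "\<And>v. v \<notin> ?F \<Longrightarrow> sum (b v) (?N v) = 0"
    by blast
  \<comment> \<open>Entries between \<open>F\<close> and its complement are set by the row outside \<open>F\<close>; the other edges are free.\<close>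
  define a where "a = (\<lambda>i j. if (i, j) \<notin> parcs G then 0
    else if i \<notin> ?F \<and> j \<in> ?F then b i j / x $ j
    else if j \<notin> ?F \<and> i \<in> ?F then b j i / x $ i else 1)"
  have a_sym: "a i j = a j i" for i j
    using arc_sym[of i j] by (auto simp: a_def)
  have a_nz: "a i j \<noteq> 0 \<longleftrightarrow> (i, j) \<in> parcs G" for i j
    using b0[of i j] b0[of j i] arc_sym[of i j] by (auto simp: a_def support_def)
  \<comment> \<open>Division by zero makes the diagonal entry 0 outside \<open>F\<close>, where its value does not affect \<open>A x\<close>.\<close>
  define A :: "real^'n^'n" where "A = (\<chi> i j. if i = j
    then - (\<Sum>k\<in>UNIV - {i}. a i k * x $ k) / x $ i else a i j)"
  have A: "A \<in> graph_matrices G"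
    using a_sym a_nz by (auto simp: graph_matrices_def A_def transpose_def vec_eq_iff)
  have "(A *v x) $ v = 0" for v
  proof (cases "x $ v = 0")
    case True
    then have v: "v \<notin> ?F" by (simp add: support_def)
    have "(A *v x) $ v = (\<Sum>w\<in>?N v. A $ v $ w * x $ w)"
      by (rule matrix_vector_row_support[OF A True])
    also have "\<dots> = sum (b v) (?N v)"
      by (rule sum.cong) (use v in \<open>auto simp: A_def a_def support_def\<close>)
    finally show ?thesis using b_sum[OF v] by simp
  next
    case False
    have "(A *v x) $ v = A $ v $ v * x $ v + (\<Sum>k\<in>UNIV - {v}. A $ v $ k * x $ k)"
      by (simp add: matrix_vector_mult_def sum.remove[of UNIV v])
    also have "(\<Sum>k\<in>UNIV - {v}. A $ v $ k * x $ k) = (\<Sum>k\<in>UNIV - {v}. a v k * x $ k)"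
      by (rule sum.cong) (auto simp: A_def)
    finally show ?thesis using False by (simp add: A_def)
  qed
  with A show ?thesis by (auto simp: vec_eq_iff)
qed

section \<open>The spark of a graph\<close>

lemma dependent_columns_iff_null_vector:
  fixes A :: "real^'n^'n"
  shows "dependent_columns A J \<longleftrightarrow> (\<exists>x. x \<noteq> 0 \<and> A *v x = 0 \<and> support x \<subseteq> J)"
proof
  assume "dependent_columns A J"
  then obtain c where c: "\<exists>j\<in>J. c j \<noteq> 0" "(\<Sum>j\<in>J. c j *\<^sub>R column j A) = 0"
    unfolding dependent_columns_def by blast
  define x :: "real^'n" where "x = (\<chi> j. if j \<in> J then c j else 0)"
  have "A *v x = (\<Sum>j\<in>UNIV. x $ j *\<^sub>R column j A)"
    by (simp add: matrix_mult_sum scalar_mult_eq_scaleR)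
  also have "\<dots> = (\<Sum>j\<in>J. c j *\<^sub>R column j A)"
    by (rule sum.mono_neutral_cong_right) (auto simp: x_def)
  finally have "A *v x = 0" using c(2) by simp
  moreover have "x \<noteq> 0" "support x \<subseteq> J"
    using c(1) by (auto simp: x_def vec_eq_iff support_def)
  ultimately show "\<exists>x. x \<noteq> 0 \<and> A *v x = 0 \<and> support x \<subseteq> J" by blast
next
  assume "\<exists>x. x \<noteq> 0 \<and> A *v x = 0 \<and> support x \<subseteq> J"
  then obtain x where x: "x \<noteq> 0" "A *v x = 0" "support x \<subseteq> J" by blast
  have "(\<Sum>j\<in>J. x $ j *\<^sub>R column j A) = (\<Sum>j\<in>UNIV. x $ j *\<^sub>R column j A)"
    by (rule sum.mono_neutral_left) (use x(3) in \<open>auto simp: support_def\<close>)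
  also have "\<dots> = A *v x"
    by (simp add: matrix_mult_sum scalar_mult_eq_scaleR)
  finally have "(\<Sum>j\<in>J. x $ j *\<^sub>R column j A) = 0"
    using x(2) by simp
  moreover have "\<exists>j\<in>J. x $ j \<noteq> 0"
    using x(1,3) by (auto simp: support_def vec_eq_iff)
  ultimately show "dependent_columns A J"
    unfolding dependent_columns_def by blast
qed

lemma not_invertible_iff_null_vector:
  fixes A :: "real^'n^'n"
  shows "\<not> invertible A \<longleftrightarrow> (\<exists>x. x \<noteq> 0 \<and> A *v x = 0)"
  unfolding invertible_left_inverse matrix_left_invertible_ker by blast

lemma spark_le_card_support:
  assumes "x \<noteq> 0" and "A *v x = 0"
  shows "spark A \<le> card (support x)"
proof -
  have "\<not> invertible A"
    using assms not_invertible_iff_null_vector by blast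
  moreover have "\<exists>J. card J = card (support x) \<and> dependent_columns A J"
    using assms dependent_columns_iff_null_vector by blast
  ultimately show ?thesis
    by (simp add: spark_def Least_le)
qed

text \<open>
  The bound \<open>CARD('n) + 1\<close> is what the convention for nonsingular matrices contributes; for
  singular ones the least dependent index set contains the support of a null vector.
\<close>

lemma spark_geI:
  fixes A :: "real^'n^'n"
  assumes "\<And>x. x \<noteq> 0 \<Longrightarrow> A *v x = 0 \<Longrightarrow> m \<le> card (support x)" and "m \<le> CARD('n) + 1"
  shows "m \<le> spark A"
proof (cases "invertible A")
  case False
  then obtain x where "x \<noteq> 0" "A *v x = 0"
    using not_invertible_iff_null_vector by blast
  then have "\<exists>s J. card J = s \<and> dependent_columns A J"
    using dependent_columns_iff_null_vector[of A "support x"] by blast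
  from LeastI_ex[OF this] have "\<exists>J. card J = spark A \<and> dependent_columns A J"
    by (simp only: spark_def False if_False)
  then obtain J where J: "card J = spark A" "dependent_columns A J" by blast
  then obtain y where y: "y \<noteq> 0" "A *v y = 0" "support y \<subseteq> J"
    using dependent_columns_iff_null_vector by blast
  have "m \<le> card (support y)" by (rule assms(1)[OF y(1,2)])
  also have "\<dots> \<le> card J" using y(3) by (simp add: card_mono)
  finally show ?thesis by (simp add: J(1))
qed (use assms(2) in \<open>simp add: spark_def\<close>)

lemma graph_spark_eq_card_minimum_fort:
  fixes G :: "'n::finite pair_pre_digraph"
  assumes sym: "sym (parcs G)" and V: "pverts G = UNIV" and F: "is_arg_min card (fort G) F"
  shows "graph_spark G = card F"
proof -
  have fort_F: "fort G F" and min: "\<And>F'. fort G F' \<Longrightarrow> card F \<le> card F'"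
    using F by (auto simp: is_arg_min_linorder)
  define x :: "real^'n" where "x = (\<chi> i. if i \<in> F then 1 else 0)"
  have supp: "support x = F" by (auto simp: x_def support_def)
  have "x \<noteq> 0" using fort_F supp by (auto simp: fort_def support_def)
  obtain A where A: "A \<in> graph_matrices G" "A *v x = 0"
    using fort_realizable[OF sym V] fort_F supp by blast
  show ?thesis
  proof (rule antisym)
    have "graph_spark G \<le> spark A"
      unfolding graph_spark_def by (rule cINF_lower) (use A in auto)
    also have "\<dots> \<le> card F"
      using spark_le_card_support[OF \<open>x \<noteq> 0\<close> A(2)] supp by simp
    finally show "graph_spark G \<le> card F" .
  next
    have "card F \<le> CARD('n)" by (simp add: card_mono)
    then have "card F \<le> spark B" if "B \<in> graph_matrices G" for B
      using min fort_support_null_vector[OF that V] by (intro spark_geI) auto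
    then show "card F \<le> graph_spark G"
      unfolding graph_spark_def using A(1) by (intro cINF_greatest) auto
  qed
qed

theorem theorem2p2:
  fixes G :: "'n::finite pair_pre_digraph"
  assumes "pair_graph G"
    and "pverts G = UNIV"
    and "Digraph_Component.connected (with_proj G)"
    and "no_isolated_vertices G"
  shows "(\<forall>A\<in>graph_matrices G. \<forall>x. x \<noteq> 0 \<and> A *v x = 0 \<longrightarrow> fort G (support x)) \<and>
    (\<forall>F x. fort G F \<and> support x = F \<longrightarrow> (\<exists>A\<in>graph_matrices G. A *v x = 0)) \<and>
    (\<exists>F. is_arg_min card (fort G) F \<and> graph_spark G = card F)"
proof -
  interpret pair_graph G by (rule assms(1))
  have sym: "sym (parcs G)"
    by (intro symI) (rule arcs_symmetric)
  have "fort G UNIV" using assms(2) by (auto simp: fort_def)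
  then obtain F where F: "is_arg_min card (fort G) F"
    using ex_has_least_nat[of "fort G" UNIV card] by (auto simp: is_arg_min_linorder)
  show ?thesis
  proof (intro conjI ballI allI impI)
    show "fort G (support x)" if "A \<in> graph_matrices G" and "x \<noteq> 0 \<and> A *v x = 0" for A x
      using fort_support_null_vector[OF that(1) assms(2)] that(2) by blast
    show "\<exists>A\<in>graph_matrices G. A *v x = 0" if "fort G F' \<and> support x = F'" for F' x
      using fort_realizable[OF sym assms(2)] that by blast
    show "\<exists>F. is_arg_min card (fort G) F \<and> graph_spark G = card F"
      using F graph_spark_eq_card_minimum_fort[OF sym assms(2) F] by blast
  qed
qed

end
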